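(* Let $n\ge 1$, let $G_{1},G_{2},\ldots ,G_{n}$ be nontrivial finite groups and let $\Gamma = G_{1}\ast G_{2}\ast \cdots \ast G_{n}$ be their free product. Then $$d\left( \widehat{\Gamma }\right) \geq n.$$
   Context: For a group $\Gamma$, $\widehat{\Gamma}$ denotes its profinite completion. For a profinite group $P$, $d(P)$ denotes the minimal number of topological generators of $P$, i.e. the smallest cardinality of a subset generating a dense subgroup of $P$. *)

theory Defs
  imports "HOL-Analysis.Analysis" "HOL-Algebra.Product_Groups"
begin

section \<open>Free products of groups\<close>

text \<open>The free product is constructed as the quotient of the free monoid on the disjoint union of
  the carriers by the congruence that identifies units with the empty word and multiplies
  neighbouring letters of the same factor.\<close>

definition fp_words :: "'i set \<Rightarrow> ('i \<Rightarrow> ('a, 'c) monoid_scheme) \<Rightarrow> ('i \<times> 'a) list set" where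
  "fp_words I G = lists (SIGMA i:I. carrier (G i))"

inductive_set fp_rel ::
  "'i set \<Rightarrow> ('i \<Rightarrow> ('a, 'c) monoid_scheme) \<Rightarrow> (('i \<times> 'a) list \<times> ('i \<times> 'a) list) set"
  for I :: "'i set" and G :: "'i \<Rightarrow> ('a, 'c) monoid_scheme" where
  refl: "u \<in> fp_words I G \<Longrightarrow> (u, u) \<in> fp_rel I G"
| sym: "(u, v) \<in> fp_rel I G \<Longrightarrow> (v, u) \<in> fp_rel I G"
| trans: "(u, v) \<in> fp_rel I G \<Longrightarrow> (v, w) \<in> fp_rel I G \<Longrightarrow> (u, w) \<in> fp_rel I G"
| one: "u \<in> fp_words I G \<Longrightarrow> v \<in> fp_words I G \<Longrightarrow> i \<in> I \<Longrightarrow>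
    (u @ [(i, \<one>\<^bsub>G i\<^esub>)] @ v, u @ v) \<in> fp_rel I G"
| mult: "u \<in> fp_words I G \<Longrightarrow> v \<in> fp_words I G \<Longrightarrow> i \<in> I \<Longrightarrow>
    x \<in> carrier (G i) \<Longrightarrow> y \<in> carrier (G i) \<Longrightarrow>
    (u @ [(i, x), (i, y)] @ v, u @ [(i, x \<otimes>\<^bsub>G i\<^esub> y)] @ v) \<in> fp_rel I G"

definition free_product ::
  "'i set \<Rightarrow> ('i \<Rightarrow> ('a, 'c) monoid_scheme) \<Rightarrow> ('i \<times> 'a) list set monoid" where
  "free_product I G =
     \<lparr>carrier = fp_words I G // fp_rel I G,
      monoid.mult = (\<lambda>A B. \<Union>u\<in>A. \<Union>v\<in>B. fp_rel I G `` {u @ v}),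
      one = fp_rel I G `` {[]}\<rparr>"

definition fp_incl ::
  "'i set \<Rightarrow> ('i \<Rightarrow> ('a, 'c) monoid_scheme) \<Rightarrow> 'i \<Rightarrow> 'a \<Rightarrow> ('i \<times> 'a) list set" where
  "fp_incl I G i x = fp_rel I G `` {[(i, x)]}"

lemma fp_words_simps [simp]:
  "[] \<in> fp_words I G"
  "p # u \<in> fp_words I G \<longleftrightarrow> fst p \<in> I \<and> snd p \<in> carrier (G (fst p)) \<and> u \<in> fp_words I G"
  "u @ v \<in> fp_words I G \<longleftrightarrow> u \<in> fp_words I G \<and> v \<in> fp_words I G"
  by (cases p; auto simp: fp_words_def)+

context
  fixes I :: "'i set" and G :: "'i \<Rightarrow> ('a, 'c) monoid_scheme"
  assumes groups: "\<And>i. i \<in> I \<Longrightarrow> group (G i)"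
begin

lemma fp_rel_words:
  assumes "(u, v) \<in> fp_rel I G"
  shows "u \<in> fp_words I G \<and> v \<in> fp_words I G"
  using assms
  by induction (auto simp: groups group.is_monoid monoid.m_closed)

lemma equiv_fp_rel: "equiv (fp_words I G) (fp_rel I G)"
proof (rule equivI)
  show "fp_rel I G \<subseteq> fp_words I G \<times> fp_words I G"
    using fp_rel_words by auto
  show "refl_on (fp_words I G) (fp_rel I G)"
    by (rule refl_onI) (rule fp_rel.refl)
  show "Relation.sym (fp_rel I G)"
    by (rule symI) (rule fp_rel.sym)
  show "Relation.trans (fp_rel I G)"
    by (rule transI) (rule fp_rel.trans)
qed

lemma fp_rel_context:
  assumes "(u, v) \<in> fp_rel I G" "a \<in> fp_words I G" "b \<in> fp_words I G"
  shows "(a @ u @ b, a @ v @ b) \<in> fp_rel I G"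
  using assms
proof induction
  case (refl u)
  then show ?case by (intro fp_rel.refl) simp
next
  case (sym u v)
  then show ?case by (blast intro: fp_rel.sym)
next
  case (trans u v w)
  then show ?case by (blast intro: fp_rel.trans)
next
  case (one u v i)
  then show ?case using fp_rel.one[of "a @ u" I G "v @ b" i] by simp
next
  case (mult u v i x y)
  then show ?case using fp_rel.mult[of "a @ u" I G "v @ b" i x y] by simp
qed

lemma fp_rel_append:
  assumes "(u, u') \<in> fp_rel I G" "(v, v') \<in> fp_rel I G"
  shows "(u @ v, u' @ v') \<in> fp_rel I G"
proof -
  have "(u @ v, u' @ v) \<in> fp_rel I G"
    using fp_rel_context[OF assms(1), of "[]" v] fp_rel_words[OF assms(2)] by simp
  moreover have "(u' @ v, u' @ v') \<in> fp_rel I G"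
    using fp_rel_context[OF assms(2), of u' "[]"] fp_rel_words[OF assms(1)] by simp
  ultimately show ?thesis by (rule fp_rel.trans)
qed

lemma free_product_mult:
  assumes "u \<in> fp_words I G" "v \<in> fp_words I G"
  shows "fp_rel I G `` {u} \<otimes>\<^bsub>free_product I G\<^esub> fp_rel I G `` {v} = fp_rel I G `` {u @ v}"
proof -
  have "fp_rel I G `` {u' @ v'} = fp_rel I G `` {u @ v}"
    if "(u, u') \<in> fp_rel I G" "(v, v') \<in> fp_rel I G" for u' v'
    using equiv_class_eq[OF equiv_fp_rel fp_rel_append[OF that]] by simp
  moreover have "(u, u) \<in> fp_rel I G" "(v, v) \<in> fp_rel I G"
    using assms by (auto intro: fp_rel.refl)
  ultimately have "(\<Union>u'\<in>fp_rel I G `` {u}. \<Union>v'\<in>fp_rel I G `` {v}. fp_rel I G `` {u' @ v'}) =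
      fp_rel I G `` {u @ v}"
    by blast
  then show ?thesis
    by (simp add: free_product_def)
qed

lemma free_product_carrierE:
  assumes "A \<in> carrier (free_product I G)"
  obtains u where "u \<in> fp_words I G" "A = fp_rel I G `` {u}"
  using assms by (auto simp: free_product_def elim: quotientE)

lemma free_product_carrierI:
  "u \<in> fp_words I G \<Longrightarrow> fp_rel I G `` {u} \<in> carrier (free_product I G)"
  by (auto simp: free_product_def intro: quotientI)

lemma fp_rel_inverse:
  assumes "u \<in> fp_words I G"
  shows "\<exists>v \<in> fp_words I G. (v @ u, []) \<in> fp_rel I G"
  using assms
proof (induction u)
  case Nil
  then show ?case by (auto intro!: bexI[of _ "[]"] fp_rel.refl)
next
  case (Cons p u)
  obtain i x where p: "p = (i, x)" by force
  with Cons.prems have i: "i \<in> I" and x: "x \<in> carrier (G i)" and u: "u \<in> fp_words I G" by auto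
  interpret group "G i" using groups i .
  obtain v where v: "v \<in> fp_words I G" "(v @ u, []) \<in> fp_rel I G" using Cons.IH u by blast
  have "(v @ [(i, inv\<^bsub>G i\<^esub> x), (i, x)] @ u, v @ [(i, inv\<^bsub>G i\<^esub> x \<otimes>\<^bsub>G i\<^esub> x)] @ u) \<in> fp_rel I G"
    using v u i x by (intro fp_rel.mult) auto
  moreover have "(v @ [(i, inv\<^bsub>G i\<^esub> x \<otimes>\<^bsub>G i\<^esub> x)] @ u, v @ u) \<in> fp_rel I G"
    using fp_rel.one[OF v(1) u i] x by simp
  ultimately have "((v @ [(i, inv\<^bsub>G i\<^esub> x)]) @ p # u, []) \<in> fp_rel I G"
    using v(2) fp_rel.trans by (simp add: p) blast
  moreover have "v @ [(i, inv\<^bsub>G i\<^esub> x)] \<in> fp_words I G" using v i x by simp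
  ultimately show ?case by blast
qed

lemma group_free_product: "group (free_product I G)"
proof (rule groupI)
  fix A B C
  assume "A \<in> carrier (free_product I G)" "B \<in> carrier (free_product I G)"
  then show "A \<otimes>\<^bsub>free_product I G\<^esub> B \<in> carrier (free_product I G)"
    by (auto elim!: free_product_carrierE simp: free_product_mult intro!: free_product_carrierI)
next
  fix A B C
  assume "A \<in> carrier (free_product I G)" "B \<in> carrier (free_product I G)"
    "C \<in> carrier (free_product I G)"
  then show "A \<otimes>\<^bsub>free_product I G\<^esub> B \<otimes>\<^bsub>free_product I G\<^esub> C =
      A \<otimes>\<^bsub>free_product I G\<^esub> (B \<otimes>\<^bsub>free_product I G\<^esub> C)"
    by (auto elim!: free_product_carrierE simp: free_product_mult)
next
  have one: "\<one>\<^bsub>free_product I G\<^esub> = fp_rel I G `` {[]}" by (simp add: free_product_def)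
  show "\<one>\<^bsub>free_product I G\<^esub> \<in> carrier (free_product I G)"
    by (simp add: one free_product_carrierI)
  fix A assume A: "A \<in> carrier (free_product I G)"
  then show "\<one>\<^bsub>free_product I G\<^esub> \<otimes>\<^bsub>free_product I G\<^esub> A = A"
    by (auto elim!: free_product_carrierE simp: one free_product_mult)
  from A obtain u where u: "u \<in> fp_words I G" "A = fp_rel I G `` {u}"
    by (rule free_product_carrierE)
  obtain v where v: "v \<in> fp_words I G" "(v @ u, []) \<in> fp_rel I G"
    using fp_rel_inverse[OF u(1)] by blast
  show "\<exists>B\<in>carrier (free_product I G). B \<otimes>\<^bsub>free_product I G\<^esub> A = \<one>\<^bsub>free_product I G\<^esub>"
    using u v equiv_class_eq[OF equiv_fp_rel v(2)]
    by (intro bexI[of _ "fp_rel I G `` {v}"])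
      (auto simp: one free_product_mult intro: free_product_carrierI)
qed

lemma fp_incl_hom:
  assumes i: "i \<in> I"
  shows "fp_incl I G i \<in> hom (G i) (free_product I G)"
proof (rule homI)
  interpret group "G i" using groups i .
  show "fp_incl I G i x \<in> carrier (free_product I G)" if "x \<in> carrier (G i)" for x
    using that i by (simp add: fp_incl_def free_product_carrierI)
  show "fp_incl I G i (x \<otimes>\<^bsub>G i\<^esub> y) = fp_incl I G i x \<otimes>\<^bsub>free_product I G\<^esub> fp_incl I G i y"
    if "x \<in> carrier (G i)" "y \<in> carrier (G i)" for x y
    using equiv_class_eq[OF equiv_fp_rel fp_rel.mult[of "[]" I G "[]" i x y]] that i
    by (simp add: fp_incl_def free_product_mult)
qed

text \<open>The universal property of the coproduct of groups.\<close>

lemma free_product_universal: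
  assumes H: "group H" and h: "\<And>i. i \<in> I \<Longrightarrow> h i \<in> hom (G i) H"
  shows "\<exists>f \<in> hom (free_product I G) H. \<forall>i\<in>I. \<forall>x\<in>carrier (G i). f (fp_incl I G i x) = h i x"
proof -
  interpret H: group H by fact
  define ev where "ev u = foldr (\<lambda>p a. h (fst p) (snd p) \<otimes>\<^bsub>H\<^esub> a) u \<one>\<^bsub>H\<^esub>" for u
  have hc: "h i x \<in> carrier H" if "i \<in> I" "x \<in> carrier (G i)" for i x
    using h that by (auto simp: hom_def)
  have evc: "ev u \<in> carrier H" if "u \<in> fp_words I G" for u
    using that by (induction u) (auto simp: ev_def hc)
  have eva: "ev (u @ v) = ev u \<otimes>\<^bsub>H\<^esub> ev v" if "u \<in> fp_words I G" "v \<in> fp_words I G" for u v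
    using that
  proof (induction u)
    case Nil
    then show ?case using evc by (simp add: ev_def)
  next
    case (Cons p u)
    have "ev (p # w) = h (fst p) (snd p) \<otimes>\<^bsub>H\<^esub> ev w" for w by (simp add: ev_def)
    with Cons hc evc show ?case by (simp add: H.m_assoc)
  qed
  have ev1: "ev [(i, x)] = h i x" if "i \<in> I" "x \<in> carrier (G i)" for i x
    using that hc by (simp add: ev_def)
  have ev_rel: "ev u = ev v" if "(u, v) \<in> fp_rel I G" for u v
    using that
  proof induction
    case (one u v i)
    interpret group "G i" using groups one by blast
    have "ev [(i, \<one>\<^bsub>G i\<^esub>)] = \<one>\<^bsub>H\<^esub>"
      using one ev1 hom_one[OF h is_group H] by simp
    with one show ?case by (simp add: eva evc del: append_Cons)
  next
    case (mult u v i x y)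
    interpret group "G i" using groups mult by blast
    have "h i (x \<otimes>\<^bsub>G i\<^esub> y) = h i x \<otimes>\<^bsub>H\<^esub> h i y"
      using mult by (intro hom_mult[OF h]) auto
    then have "ev [(i, x), (i, y)] = ev [(i, x \<otimes>\<^bsub>G i\<^esub> y)]"
      using mult eva[of "[(i, x)]" "[(i, y)]"] by (simp add: ev1)
    with mult eva[of "[(i, x), (i, y)]" v] eva[of "[(i, x \<otimes>\<^bsub>G i\<^esub> y)]" v] show ?case
      by (simp add: eva del: append_Cons)
  qed auto
  define f where "f A = ev (SOME u. u \<in> A)" for A
  have f: "f (fp_rel I G `` {u}) = ev u" if "u \<in> fp_words I G" for u
  proof -
    have "u \<in> fp_rel I G `` {u}" using that by (auto intro: fp_rel.refl)
    then have "(SOME w. w \<in> fp_rel I G `` {u}) \<in> fp_rel I G `` {u}" by (rule someI)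
    then have "(u, SOME w. w \<in> fp_rel I G `` {u}) \<in> fp_rel I G" by simp
    from ev_rel[OF this] show ?thesis by (simp add: f_def)
  qed
  have "f \<in> hom (free_product I G) H"
    by (rule homI) (auto elim!: free_product_carrierE simp: f evc eva free_product_mult)
  moreover have "f (fp_incl I G i x) = h i x" if "i \<in> I" "x \<in> carrier (G i)" for i x
    using that f[of "[(i, x)]"] by (simp add: fp_incl_def ev1)
  ultimately show ?thesis by blast
qed

lemma free_product_hom_unique:
  assumes H: "group H" and f: "f \<in> hom (free_product I G) H" and g: "g \<in> hom (free_product I G) H"
    and eq: "\<And>i x. i \<in> I \<Longrightarrow> x \<in> carrier (G i) \<Longrightarrow> f (fp_incl I G i x) = g (fp_incl I G i x)"
    and A: "A \<in> carrier (free_product I G)"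
  shows "f A = g A"
proof -
  have "f (fp_rel I G `` {u}) = g (fp_rel I G `` {u})" if "u \<in> fp_words I G" for u
    using that
  proof (induction u)
    case Nil
    have "fp_rel I G `` {[]} = \<one>\<^bsub>free_product I G\<^esub>" by (simp add: free_product_def)
    then show ?case
      using hom_one[OF f group_free_product H] hom_one[OF g group_free_product H] by simp
  next
    case (Cons p u)
    then have p: "fst p \<in> I" "snd p \<in> carrier (G (fst p))" and u: "u \<in> fp_words I G" by auto
    have "fp_rel I G `` {p # u} = fp_incl I G (fst p) (snd p) \<otimes>\<^bsub>free_product I G\<^esub> fp_rel I G `` {u}"
      using p u by (simp add: fp_incl_def free_product_mult)
    moreover have "fp_incl I G (fst p) (snd p) \<in> carrier (free_product I G)"
      using p by (simp add: fp_incl_def free_product_carrierI)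
    ultimately show ?case
      using Cons.IH[OF u] eq[OF p] u hom_mult[OF f] hom_mult[OF g] free_product_carrierI by simp
  qed
  then show ?thesis using A by (auto elim: free_product_carrierE)
qed

end

section \<open>Profinite completion\<close>

definition finite_index_normals :: "('a, 'c) monoid_scheme \<Rightarrow> 'a set set" where
  "finite_index_normals G = {N. N \<lhd> G \<and> finite (carrier (G Mod N))}"

text \<open>The inverse limit of the finite quotients of \<open>G\<close>. For normal subgroups \<open>N \<subseteq> M\<close> the map
  \<open>G Mod N \<rightarrow> G Mod M\<close> sends a coset \<open>X = N #> g\<close> to \<open>M #> g = M <#> X\<close>.\<close>

definition profinite_completion :: "('a, 'c) monoid_scheme \<Rightarrow> ('a set \<Rightarrow> 'a set) monoid" where
  "profinite_completion G =
     (product_group (finite_index_normals G) (\<lambda>N. G Mod N))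
       \<lparr>carrier := {x \<in> (\<Pi>\<^sub>E N\<in>finite_index_normals G. carrier (G Mod N)).
          \<forall>N \<in> finite_index_normals G. \<forall>M \<in> finite_index_normals G.
            N \<subseteq> M \<longrightarrow> M <#>\<^bsub>G\<^esub> x N = x M}\<rparr>"

definition profinite_topology :: "('a, 'c) monoid_scheme \<Rightarrow> ('a set \<Rightarrow> 'a set) topology" where
  "profinite_topology G =
     subtopology
       (product_topology (\<lambda>N. discrete_topology (carrier (G Mod N))) (finite_index_normals G))
       (carrier (profinite_completion G))"

lemma topspace_profinite_topology:
  "topspace (profinite_topology G) = carrier (profinite_completion G)"
  by (auto simp: profinite_topology_def profinite_completion_def)

lemma transition_map:
  assumes "N \<lhd> G" "M \<lhd> G" "N \<subseteq> M" "g \<in> carrier G"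
  shows "M <#>\<^bsub>G\<^esub> (N #>\<^bsub>G\<^esub> g) = M #>\<^bsub>G\<^esub> g"
proof -
  have G: "group G" and N: "subgroup N G" and M: "subgroup M G"
    using assms by (auto simp: normal_def)
  have "M <#>\<^bsub>G\<^esub> N = M"
  proof (intro equalityI subsetI)
    fix m assume "m \<in> M <#>\<^bsub>G\<^esub> N"
    then obtain h k where "h \<in> M" "k \<in> N" "m = h \<otimes>\<^bsub>G\<^esub> k"
      unfolding set_mult_def by blast
    then show "m \<in> M"
      using subgroup.m_closed[OF M] assms(3) by blast
  next
    fix m assume m: "m \<in> M"
    have "m = m \<otimes>\<^bsub>G\<^esub> \<one>\<^bsub>G\<^esub>"
      using monoid.r_one[OF group.is_monoid[OF G] subgroup.mem_carrier[OF M m]] by (rule HOL.sym)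
    then show "m \<in> M <#>\<^bsub>G\<^esub> N"
      using m subgroup.one_closed[OF N] unfolding set_mult_def by blast
  qed
  then show ?thesis
    using group.setmult_rcos_assoc[OF G subgroup.subset[OF M] subgroup.subset[OF N] assms(4)]
    by (rule subst[of _ _ "\<lambda>K. _ = K #>\<^bsub>G\<^esub> g"])
qed

lemma subgroup_profinite_completion:
  fixes G (structure)
  assumes "group G"
  shows "subgroup (carrier (profinite_completion G))
    (product_group (finite_index_normals G) (\<lambda>N. G Mod N))"
proof -
  interpret group G by fact
  let ?I = "finite_index_normals G"
  have grp: "group (G Mod N)" if "N \<in> ?I" for N
    using that by (auto simp: finite_index_normals_def normal.factorgroup_is_group)
  have trans: "M <#>\<^bsub>G\<^esub> X \<in> carrier (G Mod M)"
      "M <#>\<^bsub>G\<^esub> (X <#>\<^bsub>G\<^esub> Y) = (M <#>\<^bsub>G\<^esub> X) <#>\<^bsub>G\<^esub> (M <#>\<^bsub>G\<^esub> Y)"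
    if "N \<in> ?I" "M \<in> ?I" "N \<subseteq> M" "X \<in> carrier (G Mod N)" "Y \<in> carrier (G Mod N)" for N M X Y
  proof -
    from that have N: "N \<lhd> G" and M: "M \<lhd> G" by (auto simp: finite_index_normals_def)
    from \<open>X \<in> carrier (G Mod N)\<close> obtain a where "a \<in> carrier G" "X = N #> a"
      unfolding carrier_FactGroup by blast
    moreover from \<open>Y \<in> carrier (G Mod N)\<close> obtain b where "b \<in> carrier G" "Y = N #> b"
      unfolding carrier_FactGroup by blast
    ultimately show "M <#> X \<in> carrier (G Mod M)"
      "M <#> (X <#> Y) = (M <#> X) <#> (M <#> Y)"
      using N M \<open>N \<subseteq> M\<close> by (auto simp: transition_map normal.rcos_sum carrier_FactGroup)
  qed
  have th: "(\<lambda>X. M <#>\<^bsub>G\<^esub> X) \<in> hom (G Mod N) (G Mod M)"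
    if "N \<in> ?I" "M \<in> ?I" "N \<subseteq> M" for N M
    using trans[OF that] by (intro homI) simp_all
  interpret P: group "product_group ?I (\<lambda>N. G Mod N)"
    using grp by simp
  show ?thesis
  proof (rule P.subgroupI)
    show "carrier (profinite_completion G) \<subseteq> carrier (product_group ?I (\<lambda>N. G Mod N))"
      by (auto simp: profinite_completion_def)
    have "(\<lambda>N\<in>?I. N) \<in> carrier (profinite_completion G)"
      using grp[THEN group.is_monoid, THEN monoid.one_closed] hom_one[OF th grp grp]
      by (simp add: profinite_completion_def)
    then show "carrier (profinite_completion G) \<noteq> {}" by blast
  next
    fix x assume x: "x \<in> carrier (profinite_completion G)"
    then have xP: "x \<in> (\<Pi>\<^sub>E N\<in>?I. carrier (G Mod N))"
      and xc: "\<And>N M. N \<in> ?I \<Longrightarrow> M \<in> ?I \<Longrightarrow> N \<subseteq> M \<Longrightarrow> M <#> x N = x M"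
      by (auto simp: profinite_completion_def)
    have "M <#> (inv\<^bsub>G Mod N\<^esub> x N) = inv\<^bsub>G Mod M\<^esub> x M"
      if "N \<in> ?I" "M \<in> ?I" "N \<subseteq> M" for N M
    proof -
      interpret h: group_hom "G Mod N" "G Mod M" "\<lambda>X. M <#>\<^bsub>G\<^esub> X"
        using that grp th by (simp add: group_hom_def group_hom_axioms_def)
      have "x N \<in> carrier (G Mod N)" using xP that(1) by (rule PiE_mem)
      from h.hom_inv[OF this] show ?thesis using xc[OF that] by simp
    qed
    moreover have "inv\<^bsub>G Mod N\<^esub> x N \<in> carrier (G Mod N)" if "N \<in> ?I" for N
      using grp[OF that] PiE_mem[OF xP that] by (rule group.inv_closed)
    moreover have "inv\<^bsub>product_group ?I (\<lambda>N. G Mod N)\<^esub> x = (\<lambda>N\<in>?I. inv\<^bsub>G Mod N\<^esub> x N)"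
      using xP grp by (rule inv_product_group)
    ultimately show "inv\<^bsub>product_group ?I (\<lambda>N. G Mod N)\<^esub> x \<in> carrier (profinite_completion G)"
      by (simp add: profinite_completion_def)
  next
    fix x y assume "x \<in> carrier (profinite_completion G)" "y \<in> carrier (profinite_completion G)"
    then have xP: "x \<in> (\<Pi>\<^sub>E N\<in>?I. carrier (G Mod N))" "y \<in> (\<Pi>\<^sub>E N\<in>?I. carrier (G Mod N))"
      and xc: "\<And>N M. N \<in> ?I \<Longrightarrow> M \<in> ?I \<Longrightarrow> N \<subseteq> M \<Longrightarrow> M <#> x N = x M \<and> M <#> y N = y M"
      by (auto simp: profinite_completion_def)
    have "M <#> (x N <#> y N) = x M <#> y M" if "N \<in> ?I" "M \<in> ?I" "N \<subseteq> M" for N M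
      using trans(2)[OF that PiE_mem[OF xP(1) that(1)] PiE_mem[OF xP(2) that(1)]] xc[OF that]
      by simp
    moreover have "x N <#> y N \<in> carrier (G Mod N)" if "N \<in> ?I" for N
      using monoid.m_closed[OF group.is_monoid[OF grp[OF that]] PiE_mem[OF xP(1) that]
          PiE_mem[OF xP(2) that]] by simp
    ultimately show "x \<otimes>\<^bsub>product_group ?I (\<lambda>N. G Mod N)\<^esub> y \<in> carrier (profinite_completion G)"
      by (simp add: profinite_completion_def)
  qed
qed

lemma group_profinite_completion:
  assumes "group G"
  shows "group (profinite_completion G)"
proof -
  have "group (product_group (finite_index_normals G) (\<lambda>N. G Mod N))"
    by (rule product_group) (auto simp: finite_index_normals_def normal.factorgroup_is_group)
  from subgroup.subgroup_is_group[OF subgroup_profinite_completion[OF assms] this]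
  show ?thesis by (simp add: profinite_completion_def)
qed

section \<open>Number of topological generators\<close>

definition topologically_generates ::
  "('a, 'c) monoid_scheme \<Rightarrow> 'a topology \<Rightarrow> 'a set \<Rightarrow> bool" where
  "topologically_generates P T S \<longleftrightarrow>
     S \<subseteq> carrier P \<and> T closure_of (generate P S) = carrier P"

text \<open>The value is \<open>\<infinity>\<close> exactly if no finite set generates topologically; infinite cardinalities
  are not distinguished.\<close>

definition top_rank :: "('a, 'c) monoid_scheme \<Rightarrow> 'a topology \<Rightarrow> enat" where
  "top_rank P T = (INF S \<in> {S. finite S \<and> topologically_generates P T S}. enat (card S))"

end

theory Submission
  imports Defs
begin

text \<open>Suppose a finite group \<open>K\<close> acts on a finite group \<open>M \<noteq> 1\<close>, and homomorphisms \<open>G\<^sub>i \<rightarrow> K\<close> are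
  given under which no \<open>G\<^sub>i\<close> fixes a nontrivial element of \<open>M\<close>. Conjugating \<open>G\<^sub>i \<rightarrow> K \<rightarrow> M \<rtimes> K\<close> by
  elements \<open>a\<^sub>i \<in> M\<close> extends to a homomorphism \<open>\<Gamma> \<rightarrow> M \<rtimes> K\<close>. These homomorphisms agree modulo
  \<open>M\<close>, and different families \<open>a\<close> give different ones, so there are \<open>|M|\<^sup>n\<close> of them; if the
  completion is generated by \<open>d\<close> elements, there are at most \<open>|M|\<^sup>d\<close>. Hence \<open>n \<le> d\<close>.

  For \<open>K = \<Prod>\<^sub>i G\<^sub>i\<close> and \<open>p = 1 + \<Prod>\<^sub>i |G\<^sub>i|\<close>, which is prime to all \<open>|G\<^sub>i|\<close>, such an \<open>M\<close> is the
  tensor product of the augmentation modules of the \<open>G\<^sub>i\<close> over the integers modulo \<open>p\<close>.\<close>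

section \<open>Finite quotients of the profinite completion\<close>

lemma hom_eq_on_generate:
  assumes "group G" "group H" "f \<in> hom G H" "g \<in> hom G H" "T \<subseteq> carrier G"
    and eq: "\<And>t. t \<in> T \<Longrightarrow> f t = g t" and x: "x \<in> generate G T"
  shows "f x = g x"
proof -
  interpret f: group_hom G H f using assms by (simp add: group_hom_def group_hom_axioms_def)
  interpret g: group_hom G H g using assms by (simp add: group_hom_def group_hom_axioms_def)
  show ?thesis
    using x
  proof induction
    case (inv t)
    then show ?case using assms(5) eq by (metis f.hom_inv g.hom_inv subsetD)
  next
    case (eng s t)
    then show ?case using f.G.generate_in_carrier[OF assms(5)] by simp
  qed (use eq in auto)
qed

lemma profinite_projection_hom:
  assumes "N \<in> finite_index_normals G"
  shows "(\<lambda>x. x N) \<in> hom (profinite_completion G) (G Mod N)"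
  using assms by (intro homI) (auto simp: profinite_completion_def)

text \<open>This is the canonical map from \<open>G\<close> to its completion; the cosets are
  compatible by \<open>transition_map\<close>.\<close>

lemma canonical_in_profinite_completion:
  assumes "y \<in> carrier G"
  shows "(\<lambda>N\<in>finite_index_normals G. N #>\<^bsub>G\<^esub> y) \<in> carrier (profinite_completion G)"
  using assms
  by (auto simp: profinite_completion_def finite_index_normals_def carrier_FactGroup transition_map)

text \<open>The factors of the product are discrete, so fibres of a projection are open. They serve
  as the neighbourhoods against which density is tested.\<close>

lemma openin_profinite_fibre:
  assumes "N \<in> finite_index_normals G"
  shows "openin (profinite_topology G) {x \<in> carrier (profinite_completion G). x N = X}"
proof (cases "X \<in> carrier (G Mod N)")
  case True
  let ?T = "product_topology (\<lambda>N. discrete_topology (carrier (G Mod N))) (finite_index_normals G)"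
  have "openin ?T {x \<in> topspace ?T. x N \<in> {X}}"
    using True continuous_map_product_projection[OF assms]
    by (rule_tac openin_continuous_map_preimage) auto
  moreover have "{x \<in> carrier (profinite_completion G). x N = X} =
      {x \<in> topspace ?T. x N \<in> {X}} \<inter> carrier (profinite_completion G)"
    by (auto simp: profinite_completion_def)
  ultimately show ?thesis
    unfolding profinite_topology_def openin_subtopology by blast
next
  case False
  then have empty: "{x \<in> carrier (profinite_completion G). x N = X} = {}"
    using profinite_projection_hom[OF assms] by (auto simp: hom_def)
  show ?thesis unfolding empty by (rule openin_empty)
qed

text \<open>The kernel \<open>N\<close> of \<open>f\<close> has finite index because
  \<open>H\<close> is finite, so \<open>f\<close> induces a homomorphism from the completion to
  \<open>H\<close> through the \<open>N\<close>-coordinate. A dense subgroup meets every fibre over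
  \<open>G Mod N\<close>, so the subgroup generated by \<open>S\<close> already attains every value
  of \<open>f\<close>. Thus \<open>T\<close> can be the image of \<open>S\<close>.\<close>

lemma finite_image_generated:
  assumes "group G" "group H" "finite (carrier H)" "f \<in> hom G H" "finite S"
    and S: "topologically_generates (profinite_completion G) (profinite_topology G) S"
  obtains T where "T \<subseteq> f ` carrier G" "finite T" "card T \<le> card S"
    "f ` carrier G \<subseteq> generate H T"
proof -
  let ?P = "profinite_completion G"
  interpret f: group_hom G H f using assms by (simp add: group_hom_def group_hom_axioms_def)
  define N where "N = kernel G H f"
  have N: "N \<lhd> G" unfolding N_def by (rule f.normal_kernel)
  have "finite (carrier (G Mod N))"
    unfolding N_def
    using f.FactGroup_inj_on _ assms(3)
    by (rule inj_on_finite) (use f.FactGroup_hom in \<open>auto simp: hom_def\<close>)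
  then have NI: "N \<in> finite_index_normals G" using N by (simp add: finite_index_normals_def)
  obtain g where g: "g \<in> hom (G Mod N) H" "\<And>x. x \<in> carrier G \<Longrightarrow> g (N #>\<^bsub>G\<^esub> x) = f x"
    using f.FactGroup_universal_kernel[OF N] N_def by blast
  have "g \<circ> (\<lambda>x. x N) \<in> hom ?P H"
    using profinite_projection_hom[OF NI] g(1) by (rule hom_compose)
  then interpret p: group_hom ?P H "\<lambda>x. g (x N)"
    using group_profinite_completion[OF assms(1)] assms(2)
    by (simp add: group_hom_def group_hom_axioms_def comp_def)
  have SP: "S \<subseteq> carrier ?P" and dense: "(profinite_topology G) closure_of (generate ?P S) = carrier ?P"
    using S by (auto simp: topologically_generates_def)
  have "f y \<in> generate H ((\<lambda>x. g (x N)) ` S)" if y: "y \<in> carrier G" for y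
  proof -
    \<comment> \<open>\<open>?c\<close> is the image of \<open>y\<close> in the completion, and
      \<open>?U\<close> is an open neighbourhood of it on which the \<open>N\<close>-coordinate is
      constant.\<close>
    let ?c = "\<lambda>N\<in>finite_index_normals G. N #>\<^bsub>G\<^esub> y"
    let ?U = "{x \<in> carrier ?P. x N = N #>\<^bsub>G\<^esub> y}"
    have "?c \<in> (profinite_topology G) closure_of (generate ?P S)" "?c \<in> ?U"
      using canonical_in_profinite_completion[OF y] dense NI by auto
    then have "\<exists>z. z \<in> generate ?P S \<and> z \<in> ?U"
      using openin_profinite_fibre[OF NI] by (simp only: in_closure_of)
    then obtain z where z: "z \<in> generate ?P S" "z N = N #>\<^bsub>G\<^esub> y" by blast
    have "f y = g (z N)" by (simp add: z(2) g(2) y)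
    then show ?thesis using z(1) p.generate_img[OF SP] by blast
  qed
  moreover have "(\<lambda>x. g (x N)) ` S \<subseteq> f ` carrier G"
  proof clarify
    fix x assume "x \<in> S"
    then have "x N \<in> carrier (G Mod N)"
      using SP profinite_projection_hom[OF NI] by (auto simp: hom_def)
    then show "g (x N) \<in> f ` carrier G"
      by (auto simp: carrier_FactGroup g(2))
  qed
  ultimately show ?thesis
    using that[of "(\<lambda>x. g (x N)) ` S"] assms(5) card_image_le by blast
qed

section \<open>Counting homomorphisms obtained by conjugating the factors\<close>

lemma (in group) mult_inv_cancel:
  assumes "a \<in> carrier G" "x \<in> carrier G"
  shows "a \<otimes> (inv a \<otimes> x) = x" "inv a \<otimes> (a \<otimes> x) = x"
  using assms by (simp_all flip: m_assoc)

lemma conjugate_hom: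
  assumes "group G" "group H" "f \<in> hom G H" "a \<in> carrier H"
  shows "(\<lambda>x. a \<otimes>\<^bsub>H\<^esub> f x \<otimes>\<^bsub>H\<^esub> inv\<^bsub>H\<^esub> a) \<in> hom G H"
proof (rule homI)
  interpret group_hom G H f using assms by (simp add: group_hom_def group_hom_axioms_def)
  show "a \<otimes>\<^bsub>H\<^esub> f x \<otimes>\<^bsub>H\<^esub> inv\<^bsub>H\<^esub> a \<in> carrier H" if "x \<in> carrier G" for x
    using that assms(4) by simp
  show "a \<otimes>\<^bsub>H\<^esub> f (x \<otimes>\<^bsub>G\<^esub> y) \<otimes>\<^bsub>H\<^esub> inv\<^bsub>H\<^esub> a =
      a \<otimes>\<^bsub>H\<^esub> f x \<otimes>\<^bsub>H\<^esub> inv\<^bsub>H\<^esub> a \<otimes>\<^bsub>H\<^esub> (a \<otimes>\<^bsub>H\<^esub> f y \<otimes>\<^bsub>H\<^esub> inv\<^bsub>H\<^esub> a)"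
    if "x \<in> carrier G" "y \<in> carrier G" for x y
    using that assms(4) by (simp add: H.m_assoc H.mult_inv_cancel)
qed

text \<open>The counting argument, with a normal subgroup \<open>A\<close> of a finite group
  \<open>H\<close> in place of \<open>M\<close> inside the semidirect product. Normality makes the
  conjugated homomorphisms agree modulo \<open>A\<close>; \<open>centralizer\<close> makes different
  conjugating families give different homomorphisms.\<close>

lemma card_le_topological_generators:
  fixes G :: "'i \<Rightarrow> ('a, 'c) monoid_scheme" and H (structure)
  assumes "finite I" and groups: "\<And>i. i \<in> I \<Longrightarrow> group (G i)"
    and "group H" "finite (carrier H)" "A \<lhd> H" "A \<noteq> {\<one>}"
    and \<rho>: "\<And>i. i \<in> I \<Longrightarrow> \<rho> i \<in> hom (G i) H"
    and centralizer: "\<And>i a. i \<in> I \<Longrightarrow> a \<in> A \<Longrightarrow>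
      (\<And>x. x \<in> carrier (G i) \<Longrightarrow> a \<otimes> \<rho> i x = \<rho> i x \<otimes> a) \<Longrightarrow> a = \<one>"
    and "finite S" "topologically_generates (profinite_completion (free_product I G))
      (profinite_topology (free_product I G)) S"
  shows "card I \<le> card S"
proof -
  let ?\<Gamma> = "free_product I G"
  interpret H: group H by fact
  interpret A: normal A H by fact
  have \<Gamma>: "group ?\<Gamma>" using groups by (rule group_free_product)
  have A1: "1 < card A"
  proof -
    have "finite A" using A.subset assms(4) by (rule finite_subset)
    moreover have "{\<one>} \<subset> A" using assms(6) A.one_closed by auto
    ultimately have "card {\<one>} < card A" by (rule psubset_card_mono)
    then show ?thesis by simp
  qed
  \<comment> \<open>The families of conjugating elements, \<open>card A ^ card I\<close> in
    number.\<close>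
  define E where "E = (\<Pi>\<^sub>E i\<in>I. A)"
  have EA: "a i \<in> A" if "a \<in> E" "i \<in> I" for a i
    using that by (auto simp: E_def)
  define c where "c i a x = a \<otimes> \<rho> i x \<otimes> inv a" for i a x
  have \<rho>c: "\<rho> i x \<in> carrier H" if "i \<in> I" "x \<in> carrier (G i)" for i x
    using \<rho> that by (auto simp: hom_def)
  have "\<exists>f \<in> hom ?\<Gamma> H. \<forall>i\<in>I. \<forall>x\<in>carrier (G i). f (fp_incl I G i x) = c i (a i) x"
    if "a \<in> E" for a
    using groups assms(3)
  proof (rule free_product_universal)
    fix i assume i: "i \<in> I"
    then have "a i \<in> carrier H" using that A.subset by (auto simp: E_def)
    then show "c i (a i) \<in> hom (G i) H"
      unfolding c_def using i by (intro conjugate_hom groups \<rho> assms(3))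
  qed
  then obtain F where F: "\<And>a. a \<in> E \<Longrightarrow> F a \<in> hom ?\<Gamma> H"
    and Fi: "\<And>a i x. a \<in> E \<Longrightarrow> i \<in> I \<Longrightarrow> x \<in> carrier (G i) \<Longrightarrow> F a (fp_incl I G i x) = c i (a i) x"
    by metis
  text \<open>Conjugation by elements of \<open>A\<close> is invisible in \<open>H Mod A\<close>, so \<open>F a\<close> modulo \<open>A\<close> does not
    depend on \<open>a\<close>.\<close>
  have mod: "A #> F a u = A #> F b u" if "a \<in> E" "b \<in> E" "u \<in> carrier ?\<Gamma>" for a b u
  proof -
    have q: "(#>) A \<in> hom H (H Mod A)" by (rule A.r_coset_hom_Mod)
    have ci: "A #> c i t x = A #> \<rho> i x" if "i \<in> I" "x \<in> carrier (G i)" "t \<in> A" for i t x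
    proof -
      have "A #> c i t x = (A #> t) <#> (A #> \<rho> i x) <#> (A #> inv t)"
        using that \<rho>c by (simp add: c_def A.rcos_sum A.m_inv_closed)
      also have "\<dots> = A <#> (A #> \<rho> i x) <#> A"
        using that by (simp add: A.rcos_const A.m_inv_closed)
      also have "\<dots> = A #> \<rho> i x"
        using \<rho>c[OF that(1,2)] A.rcos_sum[of "\<rho> i x" \<one>] A.rcos_sum[of \<one> "\<rho> i x"]
        by (simp add: A.rcos_const)
      finally show ?thesis .
    qed
    have "((#>) A \<circ> F a) u = ((#>) A \<circ> F b) u"
      using groups A.factorgroup_is_group hom_compose[OF F[OF that(1)] q] hom_compose[OF F[OF that(2)] q] _ that(3)
      by (rule free_product_hom_unique) (use that in \<open>simp_all add: Fi ci EA\<close>)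
    then show ?thesis by simp
  qed
  \<comment> \<open>All the homomorphisms \<open>F a\<close> are packed into a single one to a
    finite power of \<open>H\<close>, so that one set \<open>T\<close> of at most
    \<open>card S\<close> tuples controls them all.\<close>
  define Q where "Q = product_group E (\<lambda>_. H)"
  define \<Phi> where "\<Phi> u = (\<lambda>a\<in>E. F a u)" for u
  have "finite E" "finite (carrier Q)"
    using assms(1,4) finite_subset[OF A.subset] by (auto simp: E_def Q_def intro!: finite_PiE)
  have Q: "group Q" unfolding Q_def by (simp add: assms(3))
  have "\<Phi> \<in> hom ?\<Gamma> Q"
    using F by (intro homI) (auto simp: Q_def \<Phi>_def hom_def)
  then obtain T where T: "T \<subseteq> \<Phi> ` carrier ?\<Gamma>" "finite T" "card T \<le> card S"
      "\<Phi> ` carrier ?\<Gamma> \<subseteq> generate Q T"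
    using finite_image_generated \<Gamma> Q \<open>finite (carrier Q)\<close> assms(9,10) by metis
  have TQ: "T \<subseteq> carrier Q" using T(1) \<open>\<Phi> \<in> hom ?\<Gamma> Q\<close> by (auto simp: hom_def)
  \<comment> \<open>The trivial family is the reference point: the values of every
    \<open>F a\<close> are compared with those of \<open>F e\<close> modulo
    \<open>A\<close>.\<close>
  define e where "e = (\<lambda>i\<in>I. \<one>)"
  have e: "e \<in> E" by (simp add: e_def E_def A.one_closed)
  \<comment> \<open>The coordinates at \<open>a\<close> of the tuples in \<open>T\<close> determine
    \<open>F a\<close> on the whole free product, because evaluation at a coordinate is a
    homomorphism on \<open>Q\<close>.\<close>
  have "inj_on (\<lambda>a. \<lambda>t\<in>T. t a) E"
  proof (rule inj_onI)
    fix a b assume ab: "a \<in> E" "b \<in> E" and eq: "(\<lambda>t\<in>T. t a) = (\<lambda>t\<in>T. t b)"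
    have proj: "(\<lambda>t. t d) \<in> hom Q H" if "d \<in> E" for d
      using that by (intro homI) (auto simp: Q_def)
    have "t a = t b" if "t \<in> generate Q T" for t
      using Q assms(3) proj[OF ab(1)] proj[OF ab(2)] TQ _ that
      by (rule hom_eq_on_generate) (metis eq restrict_apply')
    then have "\<Phi> u a = \<Phi> u b" if "u \<in> carrier ?\<Gamma>" for u
      using T(4) that by blast
    then have Fab: "F a u = F b u" if "u \<in> carrier ?\<Gamma>" for u
      using that ab by (simp add: \<Phi>_def)
    have "a i = b i" if i: "i \<in> I" for i
    proof -
      have abi: "a i \<in> A" "b i \<in> A" using ab i by (auto simp: E_def)
      then have abc: "a i \<in> carrier H" "b i \<in> carrier H" using A.subset by auto
      \<comment> \<open>If conjugation by \<open>a i\<close> and by \<open>b i\<close> has the same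
        effect on the image of \<open>\<rho> i\<close>, then this quotient centralizes that
        image.\<close>
      have "inv (b i) \<otimes> a i = \<one>"
      proof (rule centralizer[OF i])
        show "inv (b i) \<otimes> a i \<in> A" using abi by (simp add: A.m_inv_closed)
        fix x assume x: "x \<in> carrier (G i)"
        then have "fp_incl I G i x \<in> carrier ?\<Gamma>"
          using fp_incl_hom[of I G i] groups i by (auto simp: hom_def)
        from Fab[OF this] have "c i (a i) x = c i (b i) x" using ab i x by (simp add: Fi)
        then have "inv (b i) \<otimes> (c i (a i) x) \<otimes> a i = inv (b i) \<otimes> (c i (b i) x) \<otimes> a i" by simp
        then show "inv (b i) \<otimes> a i \<otimes> \<rho> i x = \<rho> i x \<otimes> (inv (b i) \<otimes> a i)"
          using abc \<rho>c[OF i x] by (simp add: c_def H.m_assoc H.mult_inv_cancel)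
      qed
      then show ?thesis using abc by (metis H.inv_equality H.inv_inv H.inv_closed)
    qed
    then show "a = b" using ab by (auto simp: E_def intro: PiE_ext)
  qed
  \<comment> \<open>Each generator leaves only one coset of \<open>A\<close>, that is
    \<open>card A\<close> values, for its coordinate at \<open>a\<close>.\<close>
  moreover have "(\<lambda>a. \<lambda>t\<in>T. t a) ` E \<subseteq> (\<Pi>\<^sub>E t\<in>T. A #> t e)"
  proof clarify
    fix a assume a: "a \<in> E"
    have "t a \<in> A #> t e" if t: "t \<in> T" for t
    proof -
      obtain u where u: "u \<in> carrier ?\<Gamma>" "t = \<Phi> u" using T(1) t by blast
      have "F a u \<in> A #> F a u" using F[OF a] u A.subset
        by (intro H.rcos_self A.is_subgroup) (auto simp: hom_def)
      then show ?thesis using mod[OF a e u(1)] a e by (simp add: u \<Phi>_def)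
    qed
    then show "(\<lambda>t\<in>T. t a) \<in> (\<Pi>\<^sub>E t\<in>T. A #> t e)" by auto
  qed
  moreover have tc: "t e \<in> carrier H" if "t \<in> T" for t
    using TQ that e by (auto simp: Q_def)
  then have fin: "finite (A #> t e)" "card (A #> t e) = card A" if "t \<in> T" for t
    using that A.subset assms(4) H.card_cosets_equal[of "A #> t e" A]
    by (auto intro: finite_subset[OF H.r_coset_subset_G] simp: H.rcosetsI dest: bij_betw_same_card)
  ultimately have "card E \<le> card (\<Pi>\<^sub>E t\<in>T. A #> t e)"
    using T(2) by (intro card_inj_on_le finite_PiE) auto
  then have "card A ^ card I \<le> card A ^ card T"
    using assms(1) T(2) fin by (simp add: E_def card_PiE)
  then have "card I \<le> card T" using A1 by simp
  with T(3) show ?thesis by simp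
qed


section \<open>Semidirect products and the bound from a group action\<close>

definition semidirect_product ::
  "('m, 'c) monoid_scheme \<Rightarrow> ('k, 'd) monoid_scheme \<Rightarrow> ('k \<Rightarrow> 'm \<Rightarrow> 'm) \<Rightarrow> ('m \<times> 'k) monoid" where
  "semidirect_product M K \<phi> =
     \<lparr>carrier = carrier M \<times> carrier K,
      monoid.mult = (\<lambda>(m, k) (m', k'). (m \<otimes>\<^bsub>M\<^esub> \<phi> k m', k \<otimes>\<^bsub>K\<^esub> k')),
      one = (\<one>\<^bsub>M\<^esub>, \<one>\<^bsub>K\<^esub>)\<rparr>"

lemma semidirect_product_simps [simp]:
  "carrier (semidirect_product M K \<phi>) = carrier M \<times> carrier K"
  "(m, k) \<otimes>\<^bsub>semidirect_product M K \<phi>\<^esub> (m', k') = (m \<otimes>\<^bsub>M\<^esub> \<phi> k m', k \<otimes>\<^bsub>K\<^esub> k')"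
  "\<one>\<^bsub>semidirect_product M K \<phi>\<^esub> = (\<one>\<^bsub>M\<^esub>, \<one>\<^bsub>K\<^esub>)"
  by (simp_all add: semidirect_product_def)

lemma group_semidirect_product:
  assumes "group M" "group K" and \<phi>: "\<And>k. k \<in> carrier K \<Longrightarrow> \<phi> k \<in> hom M M"
    and \<phi>_one: "\<And>m. m \<in> carrier M \<Longrightarrow> \<phi> \<one>\<^bsub>K\<^esub> m = m"
    and \<phi>_mult: "\<And>k l m. k \<in> carrier K \<Longrightarrow> l \<in> carrier K \<Longrightarrow> m \<in> carrier M \<Longrightarrow>
      \<phi> (k \<otimes>\<^bsub>K\<^esub> l) m = \<phi> k (\<phi> l m)"
  shows "group (semidirect_product M K \<phi>)"
proof -
  interpret M: group M by fact
  interpret K: group K by fact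
  have \<phi>c: "\<phi> k m \<in> carrier M" if "k \<in> carrier K" "m \<in> carrier M" for k m
    using \<phi> that by (auto simp: hom_def)
  have \<phi>m: "\<phi> k (m \<otimes>\<^bsub>M\<^esub> m') = \<phi> k m \<otimes>\<^bsub>M\<^esub> \<phi> k m'"
    if "k \<in> carrier K" "m \<in> carrier M" "m' \<in> carrier M" for k m m'
    using \<phi> that by (auto simp: hom_def)
  show ?thesis
  proof (rule groupI)
    fix x assume "x \<in> carrier (semidirect_product M K \<phi>)"
    then obtain m k where x: "x = (m, k)" "m \<in> carrier M" "k \<in> carrier K" by auto
    let ?y = "(\<phi> (inv\<^bsub>K\<^esub> k) (inv\<^bsub>M\<^esub> m), inv\<^bsub>K\<^esub> k)"
    have "\<phi> (inv\<^bsub>K\<^esub> k) (inv\<^bsub>M\<^esub> m) \<otimes>\<^bsub>M\<^esub> \<phi> (inv\<^bsub>K\<^esub> k) m = \<phi> (inv\<^bsub>K\<^esub> k) \<one>\<^bsub>M\<^esub>"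
      using x by (simp flip: \<phi>m)
    also have "\<dots> = \<one>\<^bsub>M\<^esub>"
      using x by (intro hom_one[OF \<phi>] assms(1)) auto
    finally show "\<exists>y\<in>carrier (semidirect_product M K \<phi>).
        y \<otimes>\<^bsub>semidirect_product M K \<phi>\<^esub> x = \<one>\<^bsub>semidirect_product M K \<phi>\<^esub>"
      using x \<phi>c by (intro bexI[of _ ?y]) auto
  qed (auto simp: \<phi>c \<phi>m \<phi>_one \<phi>_mult M.m_assoc K.m_assoc)
qed

text \<open>Inside the semidirect product, \<open>A\<close> is the kernel
  \<open>M \<times> 1\<close> of the projection to \<open>K\<close>, and \<open>G i\<close> maps to
  the complement \<open>1 \<times> K\<close>. An element \<open>(m, 1)\<close> commutes with
  \<open>(1, k)\<close> exactly when \<open>\<phi> k m = m\<close>, so \<open>fixed\<close> becomes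
  the centralizer condition.\<close>

lemma card_le_topological_generators_action:
  fixes G :: "'i \<Rightarrow> ('a, 'c) monoid_scheme"
  assumes "finite I" and groups: "\<And>i. i \<in> I \<Longrightarrow> group (G i)"
    and M: "group M" "finite (carrier M)" "carrier M \<noteq> {\<one>\<^bsub>M\<^esub>}"
    and K: "group K" "finite (carrier K)"
    and \<phi>: "\<And>k. k \<in> carrier K \<Longrightarrow> \<phi> k \<in> hom M M"
    and \<phi>_one: "\<And>m. m \<in> carrier M \<Longrightarrow> \<phi> \<one>\<^bsub>K\<^esub> m = m"
    and \<phi>_mult: "\<And>k l m. k \<in> carrier K \<Longrightarrow> l \<in> carrier K \<Longrightarrow> m \<in> carrier M \<Longrightarrow>
      \<phi> (k \<otimes>\<^bsub>K\<^esub> l) m = \<phi> k (\<phi> l m)"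
    and \<iota>: "\<And>i. i \<in> I \<Longrightarrow> \<iota> i \<in> hom (G i) K"
    and fixed: "\<And>i m. i \<in> I \<Longrightarrow> m \<in> carrier M \<Longrightarrow>
      (\<And>x. x \<in> carrier (G i) \<Longrightarrow> \<phi> (\<iota> i x) m = m) \<Longrightarrow> m = \<one>\<^bsub>M\<^esub>"
    and S: "finite S" "topologically_generates (profinite_completion (free_product I G))
      (profinite_topology (free_product I G)) S"
  shows "card I \<le> card S"
proof -
  interpret M: group M by fact
  interpret K: group K by fact
  let ?H = "semidirect_product M K \<phi>"
  have H: "group ?H"
    using M(1) K(1) \<phi> \<phi>_one \<phi>_mult by (rule group_semidirect_product)
  have \<phi>1: "\<phi> k \<one>\<^bsub>M\<^esub> = \<one>\<^bsub>M\<^esub>" if "k \<in> carrier K" for k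
    using \<phi>[OF that] M(1) by (intro hom_one)
  have \<iota>c: "\<iota> i x \<in> carrier K" if "i \<in> I" "x \<in> carrier (G i)" for i x
    using \<iota> that by (auto simp: hom_def)
  interpret snd: group_hom ?H K snd
    using H K(1) by (auto simp: group_hom_def group_hom_axioms_def hom_def)
  have "kernel ?H K snd \<lhd> ?H" by (rule snd.normal_kernel)
  moreover have A: "kernel ?H K snd = carrier M \<times> {\<one>\<^bsub>K\<^esub>}"
    by (auto simp: kernel_def)
  ultimately have "carrier M \<times> {\<one>\<^bsub>K\<^esub>} \<lhd> ?H" by simp
  moreover have "carrier M \<times> {\<one>\<^bsub>K\<^esub>} \<noteq> {\<one>\<^bsub>?H\<^esub>}"
    using M(3) by auto
  moreover have "(\<lambda>x. (\<one>\<^bsub>M\<^esub>, \<iota> i x)) \<in> hom (G i) ?H" if "i \<in> I" for i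
    using \<iota>[OF that] \<iota>c[OF that] by (intro homI) (auto simp: hom_mult \<phi>1)
  moreover have "a = \<one>\<^bsub>?H\<^esub>"
    if i: "i \<in> I" and a: "a \<in> carrier M \<times> {\<one>\<^bsub>K\<^esub>}"
      and c: "\<And>x. x \<in> carrier (G i) \<Longrightarrow> a \<otimes>\<^bsub>?H\<^esub> (\<one>\<^bsub>M\<^esub>, \<iota> i x) = (\<one>\<^bsub>M\<^esub>, \<iota> i x) \<otimes>\<^bsub>?H\<^esub> a" for i a
  proof -
    obtain m where m: "a = (m, \<one>\<^bsub>K\<^esub>)" "m \<in> carrier M" using a by auto
    have "\<phi> (\<iota> i x) m = m" if x: "x \<in> carrier (G i)" for x
    proof -
      have "\<phi> (\<iota> i x) m \<in> carrier M" using \<phi>[OF \<iota>c[OF i x]] m by (auto simp: hom_def)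
      then show ?thesis using c[OF x] m \<iota>c[OF i x] \<phi>_one by (auto simp: \<phi>1)
    qed
    then show ?thesis using fixed[OF i m(2)] m by simp
  qed
  moreover have "finite (carrier ?H)" using M(2) K(2) by simp
  ultimately show ?thesis
    using card_le_topological_generators[where H = ?H and A = "carrier M \<times> {\<one>\<^bsub>K\<^esub>}"
        and \<rho> = "\<lambda>i x. (\<one>\<^bsub>M\<^esub>, \<iota> i x)"] assms(1) groups H S
    by blast
qed

section \<open>The tensor product of augmentation modules\<close>

text \<open>The integers modulo \<open>p\<close> are realised as the \<open>p\<close>-th roots of unity, so the module is written
  multiplicatively and vanishing augmentation in a factor \<open>G\<^sub>i\<close> becomes a product condition;
  functions take the value 1 outside of \<open>\<Prod>\<^sub>i G\<^sub>i\<close>.\<close>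

definition slice_module ::
  "nat \<Rightarrow> 'i set \<Rightarrow> ('i \<Rightarrow> ('a, 'c) monoid_scheme) \<Rightarrow> (('i \<Rightarrow> 'a) \<Rightarrow> complex) monoid" where
  "slice_module p I G =
     \<lparr>carrier = {f. (\<forall>k. f k ^ p = 1) \<and> (\<forall>k. k \<notin> (\<Pi>\<^sub>E i\<in>I. carrier (G i)) \<longrightarrow> f k = 1) \<and>
        (\<forall>i\<in>I. \<forall>k \<in> (\<Pi>\<^sub>E i\<in>I. carrier (G i)). (\<Prod>x\<in>carrier (G i). f (k(i := x))) = 1)},
      monoid.mult = (\<lambda>f g k. f k * g k),
      one = (\<lambda>_. 1)\<rparr>"

text \<open>Multiplying the argument on the right yields a left action. The value 1 off the carrier
  is the convention of \<open>slice_module\<close>.\<close>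

definition translate ::
  "('k, 'c) monoid_scheme \<Rightarrow> 'k \<Rightarrow> ('k \<Rightarrow> complex) \<Rightarrow> ('k \<Rightarrow> complex)" where
  "translate K k f = (\<lambda>l. if l \<in> carrier K then f (l \<otimes>\<^bsub>K\<^esub> k) else 1)"

lemma (in group) translate_mult:
  assumes "k \<in> carrier G" "k' \<in> carrier G"
  shows "translate G (k \<otimes> k') f = translate G k (translate G k' f)"
  using assms by (simp add: translate_def m_assoc fun_eq_iff)

lemma finite_slice_module:
  assumes "finite I" "\<And>i. i \<in> I \<Longrightarrow> finite (carrier (G i))" "p > 0"
  shows "finite (carrier (slice_module p I G))"
proof (rule finite_subset)
  let ?K = "\<Pi>\<^sub>E i\<in>I. carrier (G i)"
  show "carrier (slice_module p I G) \<subseteq> {f. \<forall>k. (k \<in> ?K \<longrightarrow> f k \<in> {z. z ^ p = 1}) \<and> (k \<notin> ?K \<longrightarrow> f k = 1)}"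
    by (auto simp: slice_module_def)
  show "finite {f. \<forall>k. (k \<in> ?K \<longrightarrow> f k \<in> {z::complex. z ^ p = 1}) \<and> (k \<notin> ?K \<longrightarrow> f k = 1)}"
    using assms by (intro finite_set_of_finite_funs finite_PiE finite_roots_unity) auto
qed

lemma group_slice_module:
  assumes "p > 0"
  shows "group (slice_module p I G)"
proof (rule groupI)
  fix f assume f: "f \<in> carrier (slice_module p I G)"
  have "f k \<noteq> 0" for k
    using f assms by (auto simp: slice_module_def zero_power dest: spec[of _ k])
  then show "\<exists>g\<in>carrier (slice_module p I G).
      g \<otimes>\<^bsub>slice_module p I G\<^esub> f = \<one>\<^bsub>slice_module p I G\<^esub>"
    using f by (intro bexI[of _ "\<lambda>k. inverse (f k)"])
      (auto simp: slice_module_def power_inverse prod_inversef[unfolded comp_def])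
qed (auto simp: slice_module_def power_mult_distrib prod.distrib)

text \<open>Translation by \<open>k\<close> carries the line through \<open>l\<close> in direction
  \<open>i\<close> bijectively onto the line through \<open>l\<close> times \<open>k\<close>, so the
  slice products are only reindexed, by right multiplication with \<open>k i\<close>.\<close>

lemma translate_hom:
  assumes groups: "\<And>i. i \<in> I \<Longrightarrow> group (G i)" and k: "k \<in> (\<Pi>\<^sub>E i\<in>I. carrier (G i))"
  shows "translate (product_group I G) k \<in> hom (slice_module p I G) (slice_module p I G)"
proof (rule homI)
  let ?K = "product_group I G"
  interpret K: group ?K by (simp add: groups)
  fix f assume f: "f \<in> carrier (slice_module p I G)"
  have "(\<Prod>x\<in>carrier (G i). translate ?K k f (l(i := x))) = 1"
    if i: "i \<in> I" and l: "l \<in> carrier ?K" for i l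
  proof -
    interpret group "G i" using groups i .
    have ki: "k i \<in> carrier (G i)" using k i by auto
    have lk: "l \<otimes>\<^bsub>?K\<^esub> k \<in> carrier ?K" using k l by (intro K.m_closed) auto
    have up: "l(i := x) \<in> carrier ?K" if "x \<in> carrier (G i)" for x
      using l i that by (auto simp: PiE_iff extensional_def)
    have "(\<Prod>x\<in>carrier (G i). translate ?K k f (l(i := x))) =
        (\<Prod>x\<in>carrier (G i). f ((l \<otimes>\<^bsub>?K\<^esub> k)(i := x \<otimes>\<^bsub>G i\<^esub> k i)))"
    proof (rule prod.cong)
      fix x assume "x \<in> carrier (G i)"
      moreover have "l(i := x) \<otimes>\<^bsub>?K\<^esub> k = (l \<otimes>\<^bsub>?K\<^esub> k)(i := x \<otimes>\<^bsub>G i\<^esub> k i)"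
        using i by (auto simp: fun_eq_iff)
      ultimately show "translate ?K k f (l(i := x)) = f ((l \<otimes>\<^bsub>?K\<^esub> k)(i := x \<otimes>\<^bsub>G i\<^esub> k i))"
        using up unfolding translate_def by simp
    qed simp
    also have "\<dots> = (\<Prod>x\<in>carrier (G i). f ((l \<otimes>\<^bsub>?K\<^esub> k)(i := x)))"
      by (rule prod.reindex_bij_witness[where i = "\<lambda>x. x \<otimes>\<^bsub>G i\<^esub> inv\<^bsub>G i\<^esub> (k i)"
            and j = "\<lambda>x. x \<otimes>\<^bsub>G i\<^esub> k i"]) (auto simp: ki m_assoc)
    also have "\<dots> = 1"
      using f i lk unfolding slice_module_def by simp
    finally show ?thesis .
  qed
  then show "translate ?K k f \<in> carrier (slice_module p I G)"
    using f by (auto simp: slice_module_def translate_def)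
qed (auto simp: slice_module_def translate_def)

text \<open>Invariance under the \<open>i\<close>-th factor makes \<open>f\<close> constant on lines
  in direction \<open>i\<close>, so the slice condition says that \<open>f l\<close> has order
  dividing \<open>card (carrier (G i))\<close>. Its order also divides \<open>p\<close>, which is 1
  modulo that cardinality.\<close>

lemma slice_module_fixed:
  assumes "\<And>i. i \<in> I \<Longrightarrow> group (G i)" and i: "i \<in> I" and dvd: "p = card (carrier (G i)) * q + 1"
    and f: "f \<in> carrier (slice_module p I G)"
    and fixed: "\<And>x. x \<in> carrier (G i) \<Longrightarrow>
      translate (product_group I G) (\<lambda>j\<in>I. if j = i then x else \<one>\<^bsub>G j\<^esub>) f = f"
  shows "f = \<one>\<^bsub>slice_module p I G\<^esub>"
proof -
  let ?K = "product_group I G"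
  interpret group "G i" using assms(1) i .
  have "f l = 1" for l
  proof (cases "l \<in> carrier ?K")
    case l: True
    have li: "l i \<in> carrier (G i)" using l i by auto
    have "f (l(i := x)) = f l" if x: "x \<in> carrier (G i)" for x
    proof -
      let ?k = "\<lambda>j\<in>I. if j = i then inv\<^bsub>G i\<^esub> (l i) \<otimes>\<^bsub>G i\<^esub> x else \<one>\<^bsub>G j\<^esub>"
      have "l \<otimes>\<^bsub>?K\<^esub> ?k = l(i := x)"
        using l li x i mult_inv_cancel[OF li x] assms(1)
        by (auto simp: fun_eq_iff PiE_iff extensional_def group.is_monoid)
      moreover have "translate ?K ?k f l = f l" using fixed li x by simp
      ultimately show ?thesis using l by (simp only: translate_def if_True)
    qed
    then have "(\<Prod>x\<in>carrier (G i). f (l(i := x))) = f l ^ card (carrier (G i))" by simp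
    then have "f l ^ card (carrier (G i)) = 1"
      using f i l by (simp add: slice_module_def)
    moreover have "f l ^ p = 1" using f by (simp add: slice_module_def)
    ultimately show ?thesis by (simp add: dvd power_add power_mult)
  next
    case False
    then show ?thesis using f by (simp add: slice_module_def)
  qed
  then show ?thesis by (auto simp: slice_module_def)
qed

lemma prod_power_int:
  fixes z :: "'a :: field"
  assumes "z \<noteq> 0"
  shows "(\<Prod>x\<in>X. z powi e x) = z powi (\<Sum>x\<in>X. e x)"
  by (induction X rule: infinite_finite_induct) (simp_all add: assms power_int_add)

text \<open>Raising a root of unity to integer exponents turns an integer function with vanishing
  sums along all lines into an element of the module. A tensor product of functions of sum zero has
  vanishing line sums.\<close>

lemma slice_module_nontrivial:
  assumes "finite I" and groups: "\<And>i. i \<in> I \<Longrightarrow> group (G i)"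
    and finite: "\<And>i. i \<in> I \<Longrightarrow> finite (carrier (G i))"
    and nontrivial: "\<And>i. i \<in> I \<Longrightarrow> carrier (G i) \<noteq> {\<one>\<^bsub>G i\<^esub>}" and p: "p > 1"
  shows "carrier (slice_module p I G) \<noteq> {\<one>\<^bsub>slice_module p I G\<^esub>}"
proof -
  let ?K = "\<Pi>\<^sub>E i\<in>I. carrier (G i)"
  \<comment> \<open>There are exactly \<open>p\<close> such roots, hence more than one.\<close>
  have "\<not> {z::complex. z ^ p = 1} \<subseteq> {1}"
    using card_roots_unity_eq[of p] card_mono[of "{1}" "{z::complex. z ^ p = 1}"] p by auto
  then obtain \<zeta> :: complex where \<zeta>: "\<zeta> ^ p = 1" "\<zeta> \<noteq> 1" by blast
  then have \<zeta>0: "\<zeta> \<noteq> 0" using p by (auto simp: zero_power)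
  have one: "\<one>\<^bsub>G i\<^esub> \<in> carrier (G i)" if "i \<in> I" for i
    using groups[OF that] by (simp add: group.is_monoid)
  then have "\<exists>x. x \<in> carrier (G i) \<and> x \<noteq> \<one>\<^bsub>G i\<^esub>" if "i \<in> I" for i
    using nontrivial[OF that] that by blast
  then obtain g where g: "\<And>i. i \<in> I \<Longrightarrow> g i \<in> carrier (G i) \<and> g i \<noteq> \<one>\<^bsub>G i\<^esub>"
    by metis
  text \<open>The witness is the tensor product of the functions \<open>\<delta>\<^sub>1 - \<delta>\<^sub>g\<close> with \<open>g = g i\<close>.\<close>
  define e :: "'a \<Rightarrow> 'b \<Rightarrow> int" where
    "e i x = of_bool (x = \<one>\<^bsub>G i\<^esub>) - of_bool (x = g i)" for i x
  have e0: "(\<Sum>x\<in>carrier (G i). e i x) = 0" if "i \<in> I" for i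
    using one[OF that] g[OF that] finite[OF that]
    by (simp add: e_def sum_subtractf of_bool_def sum.delta)
  define f where "f k = (if k \<in> ?K then \<zeta> powi (\<Prod>i\<in>I. e i (k i)) else 1)" for k
  have "(\<Prod>x\<in>carrier (G i). f (k(i := x))) = 1" if i: "i \<in> I" and k: "k \<in> ?K" for i k
  proof -
    \<comment> \<open>Along a line in direction \<open>i\<close> only the \<open>i\<close>-th factor
      of the exponent varies.\<close>
    have "f (k(i := x)) = \<zeta> powi (e i x * (\<Prod>j\<in>I - {i}. e j (k j)))" if "x \<in> carrier (G i)" for x
    proof -
      have "k(i := x) \<in> ?K" using k i that by (auto simp: PiE_iff extensional_def)
      moreover have "(\<Prod>j\<in>I. e j ((k(i := x)) j)) = e i x * (\<Prod>j\<in>I - {i}. e j (k j))"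
        using assms(1) i by (simp add: prod.remove)
      ultimately show ?thesis by (simp only: f_def if_True)
    qed
    then have "(\<Prod>x\<in>carrier (G i). f (k(i := x))) =
        \<zeta> powi (\<Sum>x\<in>carrier (G i). e i x * (\<Prod>j\<in>I - {i}. e j (k j)))"
      by (simp add: prod_power_int[OF \<zeta>0])
    also have "\<dots> = 1"
      using e0[OF i] by (simp flip: sum_distrib_right)
    finally show ?thesis .
  qed
  moreover have "f k ^ p = 1" for k
  proof -
    have "(\<zeta> powi m) ^ p = 1" for m
      using \<zeta>(1) by (metis mult.commute power_int_1_left power_int_mult power_int_of_nat)
    then show ?thesis by (simp add: f_def)
  qed
  ultimately have "f \<in> carrier (slice_module p I G)"
    by (simp add: slice_module_def f_def)
  moreover have "f \<noteq> \<one>\<^bsub>slice_module p I G\<^esub>"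
  proof -
    \<comment> \<open>At the identity tuple each factor is 1, since \<open>g i\<close> is not the
      identity; there \<open>f\<close> takes the value \<open>\<zeta>\<close>.\<close>
    have "(\<Prod>i\<in>I. e i (\<one>\<^bsub>G i\<^esub>)) = 1"
      by (intro prod.neutral ballI) (use g in \<open>force simp: e_def\<close>)
    then have "f (\<lambda>i\<in>I. \<one>\<^bsub>G i\<^esub>) = \<zeta>"
      using one by (simp add: f_def)
    then show ?thesis using \<zeta>(2) by (auto simp: slice_module_def)
  qed
  ultimately show ?thesis by blast
qed

section \<open>The bound for a free product of nontrivial finite groups\<close>

theorem theorem1:
  fixes n :: nat and G :: "nat \<Rightarrow> ('a, 'b) monoid_scheme"
  assumes "n \<ge> 1"
    and "\<And>i. i \<in> {1..n} \<Longrightarrow> group (G i)"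
    and "\<And>i. i \<in> {1..n} \<Longrightarrow> finite (carrier (G i))"
    and "\<And>i. i \<in> {1..n} \<Longrightarrow> carrier (G i) \<noteq> {\<one>\<^bsub>G i\<^esub>}"
  shows "top_rank (profinite_completion (free_product {1..n} G))
           (profinite_topology (free_product {1..n} G)) \<ge> enat n"
proof -
  let ?I = "{1..n}"
  let ?K = "product_group ?I G"
  define p where "p = (\<Prod>i\<in>?I. card (carrier (G i))) + 1"
  let ?M = "slice_module p ?I G"
  \<comment> \<open>The embedding of \<open>G i\<close> as the \<open>i\<close>-th coordinate
    subgroup of the direct product.\<close>
  let ?\<iota> = "\<lambda>i x. \<lambda>j\<in>?I. if j = i then x else \<one>\<^bsub>G j\<^esub>"
  interpret K: group ?K using assms(2) by (rule product_group)
  have one: "\<one>\<^bsub>G i\<^esub> \<in> carrier (G i)" if "i \<in> ?I" for i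
    using assms(2)[OF that] by (simp add: group.is_monoid)
  have "(\<Prod>i\<in>?I. card (carrier (G i))) > 0"
    using assms(3) one by (intro prod_pos) (auto simp: card_gt_0_iff)
  then have p: "p > 1" by (simp add: p_def)
  have "card ?I \<le> card S"
    if "finite S" "topologically_generates (profinite_completion (free_product ?I G))
      (profinite_topology (free_product ?I G)) S" for S
  proof (rule card_le_topological_generators_action[where M = ?M and K = ?K
        and \<phi> = "translate ?K" and \<iota> = ?\<iota>])
    \<comment> \<open>Off the carrier of \<open>?K\<close> both sides are 1, the right one because
      \<open>f\<close> lies in the module.\<close>
    show "translate ?K \<one>\<^bsub>?K\<^esub> f = f" if "f \<in> carrier ?M" for f
    proof
      fix l
      show "translate ?K \<one>\<^bsub>?K\<^esub> f l = f l"
        using that K.r_one[of l] unfolding translate_def slice_module_def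
        by (cases "l \<in> carrier ?K") (simp_all del: one_product_group mult_product_group)
    qed
    show "translate ?K (k \<otimes>\<^bsub>?K\<^esub> k') f = translate ?K k (translate ?K k' f)"
      if "k \<in> carrier ?K" "k' \<in> carrier ?K" for k k' f
      using that by (rule K.translate_mult)
    show "?\<iota> i \<in> hom (G i) ?K" if "i \<in> ?I" for i
      using that one assms(2)
      by (intro homI) (auto simp: fun_eq_iff group.is_monoid)
    show "f = \<one>\<^bsub>?M\<^esub>"
      if "i \<in> ?I" "f \<in> carrier ?M" "\<And>x. x \<in> carrier (G i) \<Longrightarrow> translate ?K (?\<iota> i x) f = f" for i f
    proof (rule slice_module_fixed)
      \<comment> \<open>The cofactor is the product of the other orders, which exhibits
        \<open>p\<close> as 1 modulo the order of \<open>G i\<close>.\<close>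
      show "p = card (carrier (G i)) * (\<Prod>i\<in>?I - {i}. card (carrier (G i))) + 1"
        unfolding p_def using that(1) by (subst prod.remove[of _ i]) auto
    qed (use that assms(2) in auto)
    show "finite (carrier ?K)" using assms(3) by (auto intro!: finite_PiE)
    show "group ?M" using p by (intro group_slice_module) simp
    show "finite (carrier ?M)" using assms(3) p by (intro finite_slice_module) auto
    show "carrier ?M \<noteq> {\<one>\<^bsub>?M\<^esub>}"
      using assms(2-4) p by (intro slice_module_nontrivial) auto
    show "translate ?K k \<in> hom ?M ?M" if "k \<in> carrier ?K" for k
      using assms(2) that by (intro translate_hom) auto
    show "group ?K" by (rule K.is_group)
  qed (use that assms(2) in auto)
  then show ?thesis
    unfolding top_rank_def by (intro INF_greatest) auto
qed

end
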